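(* Let $(B^H_t)_{t\ge0}$ be a fractional Brownian motion with Hurst parameter $H\in(0,1)$, let $a\in\mathbb{R}$ and let $\alpha>1$. For each integer $N\ge1$, let $Y_j=j\frac aN+B^H_{j/N}$ for $j=1,\dots,N^\alpha$, let $\Gamma=(\Gamma_{i,j})_{i,j=1,\dots,N^\alpha}$ with $\Gamma_{i,j}=\mathrm{Cov}\big(B^H_{i/N},B^H_{j/N}\big)$, and let $\Gamma^{-1}_{i,j}$ denote the entries of the inverse matrix $\Gamma^{-1}$. Then the maximum likelihood estimator $$\hat a_N=N\,\frac{\sum_{i,j=1}^{N^\alpha}j\,\Gamma^{-1}_{i,j}\,Y_i}{\sum_{i,j=1}^{N^\alpha}ij\,\Gamma^{-1}_{i,j}}$$ is $L^p$ consistent for every $p\ge1$, i.e. $\mathbb{E}|\hat a_N-a|^p\to0$ as $N\to\infty$.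
   Context: Fractional Brownian motion with Hurst parameter $H$ is the centered Gaussian process with covariance $\mathbb{E}(B^H_tB^H_s)=\frac12\left(t^{2H}+s^{2H}-|t-s|^{2H}\right)$. $N^\alpha$ denotes the number of observations and is understood as its integer part $\lfloor N^\alpha\rfloor$ when it is not an integer. *)

theory Defs
  imports "HOL-Probability.Probability" "Jordan_Normal_Form.Gauss_Jordan_Elimination"
begin

text \<open>A Gaussian variable may be degenerate, i.e. almost surely constant. This case is needed
  for Gaussian processes: the zero linear combination, or the value at time 0, is Gaussian.\<close>

definition gaussian_rv :: "'w measure \<Rightarrow> ('w \<Rightarrow> real) \<Rightarrow> bool" where
  "gaussian_rv M X \<longleftrightarrow> X \<in> borel_measurable M \<and>
     (\<exists>\<mu> \<sigma>. (\<sigma> > 0 \<and> distributed M lborel X (\<lambda>x. ennreal (normal_density \<mu> \<sigma> x))) \<or>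
            (AE \<omega> in M. X \<omega> = \<mu>))"

definition gaussian_process :: "'w measure \<Rightarrow> real set \<Rightarrow> (real \<Rightarrow> 'w \<Rightarrow> real) \<Rightarrow> bool" where
  "gaussian_process M T X \<longleftrightarrow>
     (\<forall>t\<in>T. X t \<in> borel_measurable M) \<and>
     (\<forall>F c. finite F \<and> F \<subseteq> T \<longrightarrow> gaussian_rv M (\<lambda>\<omega>. \<Sum>t\<in>F. c t * X t \<omega>))"

definition cov :: "'w measure \<Rightarrow> ('w \<Rightarrow> real) \<Rightarrow> ('w \<Rightarrow> real) \<Rightarrow> real" where
  "cov M X Y = (LINT \<omega>|M. (X \<omega> - (LINT \<xi>|M. X \<xi>)) * (Y \<omega> - (LINT \<xi>|M. Y \<xi>)))"

text \<open>Only values at times \<open>t \<ge> 0\<close> are constrained. Note that \<open>0 powr (2 * H) = 0\<close>.\<close>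

definition fractional_brownian_motion ::
  "'w measure \<Rightarrow> real \<Rightarrow> (real \<Rightarrow> 'w \<Rightarrow> real) \<Rightarrow> bool" where
  "fractional_brownian_motion M H B \<longleftrightarrow>
     gaussian_process M {0..} B \<and>
     (\<forall>t\<ge>0. (LINT \<omega>|M. B t \<omega>) = 0) \<and>
     (\<forall>t\<ge>0. \<forall>s\<ge>0. (LINT \<omega>|M. B t \<omega> * B s \<omega>) =
        (t powr (2 * H) + s powr (2 * H) - \<bar>t - s\<bar> powr (2 * H)) / 2)"

definition num_obs :: "real \<Rightarrow> nat \<Rightarrow> nat" where
  "num_obs \<alpha> N = nat \<lfloor>real N powr \<alpha>\<rfloor>"

definition observation :: "real \<Rightarrow> (real \<Rightarrow> 'w \<Rightarrow> real) \<Rightarrow> nat \<Rightarrow> nat \<Rightarrow> 'w \<Rightarrow> real" where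
  "observation a B N j \<omega> = real j * (a / real N) + B (real j / real N) \<omega>"

text \<open>Matrix rows and columns are numbered from 0, whereas observations are numbered from 1:
  the entry with matrix index \<open>(i, j)\<close> belongs to the observations \<open>i + 1\<close> and \<open>j + 1\<close>.\<close>

definition obs_cov_mat ::
  "'w measure \<Rightarrow> (real \<Rightarrow> 'w \<Rightarrow> real) \<Rightarrow> nat \<Rightarrow> nat \<Rightarrow> real mat" where
  "obs_cov_mat M B N n =
     mat n n (\<lambda>(i, j). cov M (B (real (i + 1) / real N)) (B (real (j + 1) / real N)))"

definition inv_entry :: "real mat \<Rightarrow> nat \<Rightarrow> nat \<Rightarrow> real" where
  "inv_entry G i j = the (mat_inverse G) $$ (i - 1, j - 1)"

definition drift_mle ::
  "'w measure \<Rightarrow> (real \<Rightarrow> 'w \<Rightarrow> real) \<Rightarrow> real \<Rightarrow> real \<Rightarrow> nat \<Rightarrow> 'w \<Rightarrow> real" where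
  "drift_mle M B \<alpha> a N \<omega> =
     (let n = num_obs \<alpha> N; G = obs_cov_mat M B N n in
        real N *
        ((\<Sum>i=1..n. \<Sum>j=1..n. real j * inv_entry G i j * observation a B N i \<omega>) /
         (\<Sum>i=1..n. \<Sum>j=1..n. real i * real j * inv_entry G i j)))"

text \<open>The Bochner integral of a non-integrable function is 0, so membership in
  \<open>L\<^sup>p\<close> is required explicitly.\<close>

definition Lp_consistent ::
  "'w measure \<Rightarrow> real \<Rightarrow> (nat \<Rightarrow> 'w \<Rightarrow> real) \<Rightarrow> real \<Rightarrow> bool" where
  "Lp_consistent M p est \<theta> \<longleftrightarrow>
     (\<forall>N\<ge>1. est N \<in> borel_measurable M \<and> integrable M (\<lambda>\<omega>. \<bar>est N \<omega> - \<theta>\<bar> powr p)) \<and>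
     (\<lambda>N. LINT \<omega>|M. \<bar>est N \<omega> - \<theta>\<bar> powr p) \<longlonglongrightarrow> 0"

end

theory Submission
  imports Defs "Jordan_Normal_Form.Determinant" "HOL-Real_Asymp.Real_Asymp"
begin

text \<open>If \<open>u\<close> solves \<open>\<Gamma> u = v\<close> for \<open>v = (1, \<dots>, n)\<close> and \<open>D = v \<bullet> u\<close>, the estimation error is the
  centred Gaussian variable \<open>N / D * (\<Sum>i. u\<^sub>i B\<^bsub>i/N\<^esub>)\<close>, of variance \<open>N\<^sup>2 / D\<close>. The Cauchy-Schwarz
  inequality, applied to \<open>\<Sum>i. u\<^sub>i B\<^bsub>i/N\<^esub>\<close> and \<open>B\<^bsub>n/N\<^esub>\<close>, bounds this variance by \<open>(n/N) powr (2H - 2)\<close>,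
  which tends to 0 since \<open>H < 1\<close> and \<open>n/N\<close> tends to infinity; Gaussian absolute moments are powers
  of the variance. That \<open>\<Gamma>\<close> is invertible follows from the singularities of the covariance: a null
  combination of \<open>B\<^bsub>i/N\<^esub>\<close> is orthogonal to every \<open>B\<^sub>t\<close>, hence
  \<open>\<Sum>i. w\<^sub>i \<bar>i/N - t\<bar> powr (2H)\<close> is a combination of \<open>1\<close> and \<open>t powr (2H)\<close>,
  smooth at each \<open>t = i/N\<close>, which forces \<open>w = 0\<close>.\<close>

section \<open>Second differences of absolute powers, and linear independence of the covariance
  functions\<close>

text \<open>Away from 0 the power function is smooth, so its second difference is of order
  \<open>h ^ 2\<close>, which is negligible against \<open>h powr s\<close> because
  \<open>s < 2\<close>.\<close>

lemma second_difference_abs_powr_pos: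
  fixes d s :: real
  assumes "0 < d" "0 < s" "s < 2"
  shows "((\<lambda>h. (\<bar>d + h\<bar> powr s + \<bar>d - h\<bar> powr s - 2 * \<bar>d\<bar> powr s) / h powr s) \<longlongrightarrow> 0) (at_right 0)"
proof -
  have small: "eventually (\<lambda>h. 0 < h \<and> h < d) (at_right 0)"
    using eventually_at_right_real[of 0 d] assms by simp
  have "((\<lambda>h. ((d + h) powr s + (d - h) powr s - 2 * d powr s) / h powr s) \<longlongrightarrow> 0) (at_right 0)"
  proof (rule lhopital_right_0)
    have "((\<lambda>h. (d + h) powr s + (d - h) powr s - 2 * d powr s)
        \<longlongrightarrow> (d + 0) powr s + (d - 0) powr s - 2 * d powr s) (at_right 0)"
      using assms by (intro tendsto_intros) auto
    then show "((\<lambda>h. (d + h) powr s + (d - h) powr s - 2 * d powr s) \<longlongrightarrow> 0) (at_right 0)"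
      by simp
    show "((\<lambda>h. h powr s) \<longlongrightarrow> 0) (at_right 0)"
      using assms by (auto intro!: tendsto_eq_intros tendsto_zero_powrI eventually_at_rightI[of 0 1])
    show "eventually (\<lambda>h. h powr s \<noteq> 0) (at_right 0)"
      using small by eventually_elim auto
    show "eventually (\<lambda>h. s * h powr (s - 1) \<noteq> 0) (at_right 0)"
      using small by eventually_elim (use assms in auto)
    show "eventually (\<lambda>h. ((\<lambda>h. (d + h) powr s + (d - h) powr s - 2 * d powr s)
        has_real_derivative s * ((d + h) powr (s - 1) - (d - h) powr (s - 1))) (at h)) (at_right 0)"
      using small
      by eventually_elim (use assms in \<open>auto intro!: derivative_eq_intros simp: algebra_simps\<close>)
    show "eventually (\<lambda>h. ((\<lambda>h. h powr s) has_real_derivative s * h powr (s - 1)) (at h)) (at_right 0)"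
      using small by eventually_elim (auto intro!: derivative_eq_intros)
    \<comment> \<open>The quotient of the derivatives is split in two factors: a first difference
      divided by \<open>h\<close>, which tends to a derivative, and \<open>h powr (2 - s)\<close>,
      which tends to 0.\<close>
    have "((\<lambda>h. (d + h) powr (s - 1) - (d - h) powr (s - 1)) has_real_derivative
        (s - 1) * d powr (s - 2) * 2) (at 0)"
      using assms by (auto intro!: derivative_eq_intros simp: algebra_simps)
    then have "((\<lambda>h. ((d + h) powr (s - 1) - (d - h) powr (s - 1)) / h)
        \<longlongrightarrow> (s - 1) * d powr (s - 2) * 2) (at_right 0)"
      by (simp add: DERIV_def filterlim_at_split)
    moreover have "((\<lambda>h::real. h powr (2 - s)) \<longlongrightarrow> 0) (at_right 0)"
      using assms by (auto intro!: tendsto_eq_intros tendsto_zero_powrI eventually_at_rightI[of 0 1])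
    ultimately have "((\<lambda>h. ((d + h) powr (s - 1) - (d - h) powr (s - 1)) / h * h powr (2 - s))
        \<longlongrightarrow> (s - 1) * d powr (s - 2) * 2 * 0) (at_right 0)"
      by (rule tendsto_mult)
    moreover have "eventually (\<lambda>h. ((d + h) powr (s - 1) - (d - h) powr (s - 1)) / h * h powr (2 - s)
        = s * ((d + h) powr (s - 1) - (d - h) powr (s - 1)) / (s * h powr (s - 1))) (at_right 0)"
      using small
    proof eventually_elim
      case (elim h)
      have "h powr (2 - s) = h / h powr (s - 1)"
        using elim powr_diff[of h 1 "s - 1"] by (simp add: algebra_simps)
      then show ?case
        using assms elim by (simp only:) simp
    qed
    ultimately show "((\<lambda>h. s * ((d + h) powr (s - 1) - (d - h) powr (s - 1)) / (s * h powr (s - 1)))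
        \<longlongrightarrow> 0) (at_right 0)"
      by (simp add: filterlim_cong)
  qed
  moreover have "eventually (\<lambda>h. ((d + h) powr s + (d - h) powr s - 2 * d powr s) / h powr s
      = (\<bar>d + h\<bar> powr s + \<bar>d - h\<bar> powr s - 2 * \<bar>d\<bar> powr s) / h powr s) (at_right 0)"
    using small by eventually_elim (use assms in auto)
  ultimately show ?thesis
    by (simp add: filterlim_cong)
qed

text \<open>The limit tells the singularity from all other points: at \<open>d = 0\<close> the
  quotient is constantly 2 for \<open>h > 0\<close>, and evenness in \<open>d\<close> reduces
  negative \<open>d\<close> to the positive case.\<close>

lemma second_difference_abs_powr:
  fixes d s :: real
  assumes "0 < s" "s < 2"
  shows "((\<lambda>h. (\<bar>d + h\<bar> powr s + \<bar>d - h\<bar> powr s - 2 * \<bar>d\<bar> powr s) / h powr s)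
    \<longlongrightarrow> (if d = 0 then 2 else 0)) (at_right 0)"
proof (cases "d = 0")
  case True
  have "eventually (\<lambda>h::real. h > 0) (at_right 0)"
    by (simp add: eventually_at_right_less)
  then have "eventually (\<lambda>h. (\<bar>d + h\<bar> powr s + \<bar>d - h\<bar> powr s - 2 * \<bar>d\<bar> powr s) / h powr s = 2) (at_right 0)"
    by eventually_elim (use True in auto)
  then show ?thesis
    using True by (simp add: tendsto_eventually)
next
  case False
  have "\<bar>\<bar>d\<bar> + h\<bar> powr s + \<bar>\<bar>d\<bar> - h\<bar> powr s = \<bar>d + h\<bar> powr s + \<bar>d - h\<bar> powr s" for h
    by (cases "d > 0") (auto simp: abs_minus_commute add.commute)
  then show ?thesis
    using second_difference_abs_powr_pos[of "\<bar>d\<bar>" s] assms False by simp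
qed

definition fbm_cov :: "real \<Rightarrow> real \<Rightarrow> real \<Rightarrow> real" where
  "fbm_cov H t s = (t powr (2 * H) + s powr (2 * H) - \<bar>t - s\<bar> powr (2 * H)) / 2"

lemma fbm_cov_commute: "fbm_cov H t s = fbm_cov H s t"
  by (simp add: fbm_cov_def abs_minus_commute)

text \<open>As a function of \<open>t\<close>, the covariance \<open>fbm_cov H x t\<close> has a singularity of order
  \<open>h powr (2 * H)\<close> at \<open>t = x\<close> and only there; second differences detect it because \<open>2 * H < 2\<close>.\<close>

lemma fbm_cov_linear_independent:
  assumes H: "0 < H" "H < 1" and I: "finite I" "inj_on x I" "\<And>i. i \<in> I \<Longrightarrow> 0 < x i"
    and zero: "\<And>t. 0 \<le> t \<Longrightarrow> (\<Sum>i\<in>I. c i * fbm_cov H (x i) t) = 0"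
    and k: "k \<in> I"
  shows "c k = 0"
proof -
  define s \<tau> where "s = 2 * H" and "\<tau> = x k"
  have s: "0 < s" "s < 2" and \<tau>: "0 < \<tau>"
    using H I k by (auto simp: s_def \<tau>_def)
  define \<Delta> where "\<Delta> d h = \<bar>d + h\<bar> powr s + \<bar>d - h\<bar> powr s - 2 * \<bar>d\<bar> powr s" for d h :: real
  have \<Delta>_lim: "((\<lambda>h. \<Delta> d h / h powr s) \<longlongrightarrow> (if d = 0 then 2 else 0)) (at_right 0)" for d
    unfolding \<Delta>_def by (rule second_difference_abs_powr[OF s])
  \<comment> \<open>The hypothesis \<open>zero\<close>, solved for the singular terms. The absolute
    value around \<open>t\<close> lets \<open>\<Delta>\<close> apply to the right side as
    well.\<close>
  have sing: "(\<Sum>i\<in>I. c i * \<bar>x i - t\<bar> powr s)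
      = (\<Sum>i\<in>I. c i * x i powr s) + (\<Sum>i\<in>I. c i) * \<bar>t\<bar> powr s" if "0 \<le> t" for t
  proof -
    have "(\<Sum>i\<in>I. c i * fbm_cov H (x i) t) = ((\<Sum>i\<in>I. c i * x i powr s) + (\<Sum>i\<in>I. c i) * \<bar>t\<bar> powr s
        - (\<Sum>i\<in>I. c i * \<bar>x i - t\<bar> powr s)) / 2"
      using that by (simp add: fbm_cov_def s_def sum_distrib_right sum_subtractf[symmetric]
          sum.distrib[symmetric] sum_divide_distrib algebra_simps)
    then show ?thesis
      using zero[OF that] by simp
  qed
  \<comment> \<open>Second difference at \<tau> of the left side of \<open>sing\<close>, term by
    term: by injectivity of \<open>x\<close> only the term of \<open>k\<close> survives in the
    limit.\<close>
  have "((\<lambda>h. \<Sum>i\<in>I. c i * (\<Delta> (x i - \<tau>) h / h powr s))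
      \<longlongrightarrow> (\<Sum>i\<in>I. c i * (if x i - \<tau> = 0 then 2 else 0))) (at_right 0)"
    by (intro tendsto_sum tendsto_mult tendsto_const \<Delta>_lim)
  moreover have "(\<Sum>i\<in>I. c i * (if x i - \<tau> = 0 then 2 else 0)) = 2 * c k"
  proof -
    have "(\<Sum>i\<in>I. c i * (if x i - \<tau> = 0 then 2 else 0)) = (\<Sum>i\<in>I. if i = k then 2 * c i else 0)"
      using I(2) k by (intro sum.cong) (auto simp: \<tau>_def inj_on_def)
    then show ?thesis
      using I(1) k by simp
  qed
  \<comment> \<open>The same second difference from the right side of \<open>sing\<close>: the
    constant cancels, and the rest tends to 0 since \<tau> > 0. The bound \<open>h < \<tau>\<close>
    keeps \<open>\<tau> - h\<close> in the range of \<open>sing\<close>.\<close>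
  moreover have "eventually (\<lambda>h. (\<Sum>i\<in>I. c i * (\<Delta> (x i - \<tau>) h / h powr s))
      = (\<Sum>i\<in>I. c i) * (\<Delta> \<tau> h / h powr s)) (at_right 0)"
  proof -
    have "eventually (\<lambda>h. 0 < h \<and> h < \<tau>) (at_right 0)"
      using eventually_at_right_real[of 0 \<tau>] \<tau> by simp
    then show ?thesis
    proof eventually_elim
      case (elim h)
      have "(\<Sum>i\<in>I. c i * \<Delta> (x i - \<tau>) h) = (\<Sum>i\<in>I. c i * \<bar>x i - (\<tau> - h)\<bar> powr s)
          + (\<Sum>i\<in>I. c i * \<bar>x i - (\<tau> + h)\<bar> powr s) - 2 * (\<Sum>i\<in>I. c i * \<bar>x i - \<tau>\<bar> powr s)"
        by (simp add: \<Delta>_def sum_distrib_left sum_subtractf[symmetric]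
          sum.distrib[symmetric] algebra_simps)
      also have "\<dots> = (\<Sum>i\<in>I. c i) * \<Delta> \<tau> h"
        using sing[of "\<tau> - h"] sing[of "\<tau> + h"] sing[of \<tau>] elim \<tau>
        by (simp add: \<Delta>_def algebra_simps)
      finally show ?case
        by (simp add: sum_divide_distrib[symmetric])
    qed
  qed
  ultimately have "((\<lambda>h. (\<Sum>i\<in>I. c i) * (\<Delta> \<tau> h / h powr s)) \<longlongrightarrow> 2 * c k) (at_right 0)"
    by (simp add: filterlim_cong)
  moreover have "((\<lambda>h. (\<Sum>i\<in>I. c i) * (\<Delta> \<tau> h / h powr s)) \<longlongrightarrow> 0) (at_right 0)"
    using tendsto_mult_left[OF \<Delta>_lim[of \<tau>]] \<tau> by auto
  ultimately show "c k = 0"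
    using tendsto_unique[of "at_right (0::real)"] by (metis mult_eq_0_iff trivial_limit_at_right_real zero_neq_numeral)
qed

section \<open>Entries of the inverse matrix as solutions of linear systems\<close>

text \<open>A trivial kernel makes the determinant nonzero, so \<open>mat_inverse\<close> returns a
  genuine inverse and the \<open>the\<close> in \<open>inv_entry\<close> is meaningful. The function
  \<open>g\<close> carries the indices of the observations, which start at 1.\<close>

lemma inv_entry_solves:
  assumes G: "G = mat n n (\<lambda>(i, j). g (i + 1) (j + 1))"
    and kernel: "\<And>w. (\<And>i. i \<in> {1..n} \<Longrightarrow> (\<Sum>j=1..n. g i j * w j) = 0) \<Longrightarrow> \<forall>i\<in>{1..n}. w i = 0"
    and i: "i \<in> {1..n}"
  shows "(\<Sum>j=1..n. g i j * (\<Sum>k=1..n. inv_entry G j k * v k)) = v i"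
proof -
  have shift: "(\<Sum>j=1..n. f j) = (\<Sum>j=0..<n. f (j + 1))" for f :: "nat \<Rightarrow> real"
    using sum.shift_bounds_nat_ivl[of f 0 1 n] by (simp add: atLeastLessThanSuc_atLeastAtMost)
  have carrier: "G \<in> carrier_mat n n"
    by (simp add: G)
  have "Determinant.det G \<noteq> 0"
  proof
    assume "Determinant.det G = 0"
    then obtain w where w: "w \<in> carrier_vec n" "w \<noteq> 0\<^sub>v n" "G *\<^sub>v w = 0\<^sub>v n"
      using det_0_iff_vec_prod_zero[OF carrier] by blast
    have "\<forall>i\<in>{1..n}. w $ (i - 1) = 0"
    proof (rule kernel)
      fix i assume "i \<in> {1..n}"
      then have "(G *\<^sub>v w) $ (i - 1) = (\<Sum>j=1..n. g i j * w $ (j - 1))"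
        using w(1) unfolding shift by (auto simp: G scalar_prod_def)
      then show "(\<Sum>j=1..n. g i j * w $ (j - 1)) = 0"
        using w(3) \<open>i \<in> {1..n}\<close> by auto
    qed
    then have "w = 0\<^sub>v n"
      using w(1) by (intro eq_vecI) (force dest: bspec[of _ _ "Suc _"])+
    with w(2) show False ..
  qed
  then have "mat_inverse G \<noteq> None"
    using mat_inverse(1)[OF carrier, of "()"] det_non_zero_imp_unit[OF carrier, of "()"] by blast
  then obtain K where K: "mat_inverse G = Some K" by blast
  then have GK: "G * K = 1\<^sub>m n" "K \<in> carrier_mat n n"
    using mat_inverse(2)[OF carrier K] by auto
  have entry: "(\<Sum>j=1..n. g i j * inv_entry G j k) = (if i = k then 1 else 0)" if "k \<in> {1..n}" for k
  proof -
    have "(G * K) $$ (i - 1, k - 1) = (\<Sum>j=1..n. g i j * inv_entry G j k)"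
      using that i GK(2) unfolding shift inv_entry_def K by (auto simp: G scalar_prod_def)
    \<comment> \<open>Truncated subtraction is harmless, as both indices are at least 1.\<close>
    moreover have "i - 1 = k - 1 \<longleftrightarrow> i = k"
      using that i by auto
    moreover have "i - 1 < n" "k - 1 < n"
      using that i by auto
    ultimately show ?thesis
      by (simp add: GK(1) del: One_nat_def)
  qed
  have "(\<Sum>j=1..n. g i j * (\<Sum>k=1..n. inv_entry G j k * v k))
      = (\<Sum>k=1..n. (\<Sum>j=1..n. g i j * inv_entry G j k) * v k)"
    by (simp add: sum_distrib_left sum_distrib_right mult.assoc) (rule sum.swap)
  also have "\<dots> = (\<Sum>k=1..n. if i = k then v k else 0)"
    by (intro sum.cong refl) (simp only: entry, simp)
  also have "\<dots> = v i"
    using i by simp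
  finally show ?thesis .
qed

section \<open>Absolute moments of centred Gaussian variables\<close>

text \<open>Domination by \<open>1 + \<bar>x\<bar> ^ k\<close>, with \<open>k\<close> the ceiling of
  \<open>p\<close>, reduces real exponents to integer ones.\<close>

lemma integrable_std_normal_abs_powr:
  assumes "0 \<le> p"
  shows "integrable lborel (\<lambda>x. std_normal_density x * \<bar>x\<bar> powr p)"
proof -
  define k where "k = nat \<lceil>p\<rceil>"
  have "\<bar>x\<bar> powr p \<le> 1 + \<bar>x\<bar> ^ k" for x :: real
  proof (cases "\<bar>x\<bar> \<le> 1")
    case True
    then have "\<bar>x\<bar> powr p \<le> 1"
      using assms by (intro powr_le1) auto
    then show ?thesis
      by (simp add: add_increasing2)
  next
    case False
    then have "\<bar>x\<bar> powr p \<le> \<bar>x\<bar> powr real k"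
      using assms by (intro powr_mono) (auto simp: k_def)
    then show ?thesis
      using False by (simp add: powr_realpow)
  qed
  then have bound: "std_normal_density x * \<bar>x\<bar> powr p
      \<le> std_normal_density x + std_normal_density x * \<bar>x\<bar> ^ k" for x
    using mult_left_mono[of "\<bar>x\<bar> powr p" "1 + \<bar>x\<bar> ^ k" "std_normal_density x"]
    by (simp add: distrib_left)
  have "integrable lborel (\<lambda>x. std_normal_density x + std_normal_density x * \<bar>x\<bar> ^ k)"
    using integrable_std_normal_moment_abs[of 0] integrable_std_normal_moment_abs[of k] by simp
  then show ?thesis
    by (rule Bochner_Integration.integrable_bound) (auto intro!: AE_I2 order_trans[OF bound])
qed

context prob_space
begin

text \<open>\<open>X / \<sigma>\<close> is standard normal, and \<open>\<sigma> powr p\<close> is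
  the variance to the power \<open>p / 2\<close>. Phrased through the second moment, the formula
  also covers the degenerate case.\<close>

lemma gaussian_rv_abs_moment:
  assumes X: "gaussian_rv M X" "expectation X = 0" and p: "0 < p"
  shows "integrable M (\<lambda>\<omega>. \<bar>X \<omega>\<bar> powr p)" (is ?int)
    and "expectation (\<lambda>\<omega>. \<bar>X \<omega>\<bar> powr p) = expectation (\<lambda>\<omega>. (X \<omega>)\<^sup>2) powr (p / 2) *
      (LINT x|lborel. std_normal_density x * \<bar>x\<bar> powr p)" (is ?eq)
proof -
  have [measurable]: "X \<in> borel_measurable M"
    using X by (simp add: gaussian_rv_def)
  from X(1) consider (nondegenerate) \<mu> \<sigma> where
      "0 < \<sigma>" "distributed M lborel X (\<lambda>x. ennreal (normal_density \<mu> \<sigma> x))"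
    | (degenerate) \<mu> where "AE \<omega> in M. X \<omega> = \<mu>"
    unfolding gaussian_rv_def by blast
  then have "?int \<and> ?eq"
  proof cases
    case nondegenerate
    then have [simp]: "\<mu> = 0"
      using normal_distributed_expectation X(2) by metis
    have var: "expectation (\<lambda>\<omega>. (X \<omega>)\<^sup>2) = \<sigma>\<^sup>2"
      using normal_distributed_variance[OF nondegenerate] X(2) by simp
    have D: "distributed M lborel (\<lambda>\<omega>. X \<omega> / \<sigma>) std_normal_density"
      using nondegenerate normal_standard_normal_convert[of \<sigma> X 0] by simp
    have int: "integrable M (\<lambda>\<omega>. \<bar>X \<omega> / \<sigma>\<bar> powr p)"
      using distributed_integrable[OF D, of "\<lambda>x. \<bar>x\<bar> powr p"]
        integrable_std_normal_abs_powr[of p] p by simp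
    have eq: "expectation (\<lambda>\<omega>. \<bar>X \<omega> / \<sigma>\<bar> powr p) = (LINT x|lborel. std_normal_density x * \<bar>x\<bar> powr p)"
      using distributed_integral[OF D, of "\<lambda>x. \<bar>x\<bar> powr p"] by simp
    have scale: "\<bar>X \<omega>\<bar> powr p = \<sigma> powr p * \<bar>X \<omega> / \<sigma>\<bar> powr p" for \<omega>
      using nondegenerate(1) by (simp add: powr_mult[symmetric] abs_divide)
    have "(\<sigma>\<^sup>2) powr (p / 2) = \<sigma> powr p"
      using nondegenerate(1) by (simp add: powr_powr flip: powr_numeral)
    then show ?thesis
      unfolding scale var using int eq by simp
  next
    case degenerate
    \<comment> \<open>A constant with mean zero is 0, so both sides of the formula vanish.\<close>
    then have "expectation X = expectation (\<lambda>_. \<mu>)"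
      by (intro integral_cong_AE) auto
    then have zero: "AE \<omega> in M. X \<omega> = 0"
      using degenerate X(2) by (simp add: prob_space)
    have int: "integrable M (\<lambda>\<omega>. \<bar>X \<omega>\<bar> powr p) \<longleftrightarrow> integrable M (\<lambda>_. 0 :: real)"
      using zero by (intro integrable_cong_AE) auto
    have "expectation (\<lambda>\<omega>. \<bar>X \<omega>\<bar> powr p) = expectation (\<lambda>_. 0)"
      using zero by (intro integral_cong_AE) auto
    moreover have "expectation (\<lambda>\<omega>. (X \<omega>)\<^sup>2) = expectation (\<lambda>_. 0)"
      using zero by (intro integral_cong_AE) auto
    ultimately show ?thesis
      using int by simp
  qed
  then show ?int ?eq by blast+
qed

end

section \<open>Second-order properties of linear combinations of fractional Brownian motion\<close>

locale fbm = prob_space M for M :: "'w measure" +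
  fixes H :: real and B :: "real \<Rightarrow> 'w \<Rightarrow> real"
  assumes hurst: "0 < H" "H < 1"
    and fbm: "fractional_brownian_motion M H B"
begin

lemma measurable_B [measurable]: "0 \<le> t \<Longrightarrow> B t \<in> borel_measurable M"
  using fbm by (simp add: fractional_brownian_motion_def gaussian_process_def)

lemma expectation_B: "0 \<le> t \<Longrightarrow> expectation (B t) = 0"
  using fbm by (simp add: fractional_brownian_motion_def)

lemma expectation_B_mult:
  "0 \<le> t \<Longrightarrow> 0 \<le> s \<Longrightarrow> expectation (\<lambda>\<omega>. B t \<omega> * B s \<omega>) = fbm_cov H t s"
  using fbm by (simp add: fractional_brownian_motion_def fbm_cov_def)

text \<open>\<open>gaussian_process\<close> indexes coefficients by times; injectivity of
  \<open>x\<close> gives each time the coefficient of its unique index.\<close>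

lemma gaussian_linear_combination:
  assumes "finite I" "inj_on x I" "\<And>i. i \<in> I \<Longrightarrow> 0 \<le> x i"
  shows "gaussian_rv M (\<lambda>\<omega>. \<Sum>i\<in>I. c i * B (x i) \<omega>)"
proof -
  have "\<forall>F c. finite F \<and> F \<subseteq> {0..} \<longrightarrow> gaussian_rv M (\<lambda>\<omega>. \<Sum>t\<in>F. c t * B t \<omega>)"
    using fbm unfolding fractional_brownian_motion_def gaussian_process_def by (elim conjE)
  from this[rule_format, of "x ` I" "\<lambda>t. c (the_inv_into I x t)"]
  have "gaussian_rv M (\<lambda>\<omega>. \<Sum>t\<in>x ` I. c (the_inv_into I x t) * B t \<omega>)"
    using assms by auto
  then show ?thesis
    using assms by (simp add: sum.reindex the_inv_into_f_f)
qed

lemma gaussian_B: "0 \<le> t \<Longrightarrow> gaussian_rv M (B t)"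
  using gaussian_linear_combination[of "{()}" "\<lambda>_. t" "\<lambda>_. 1"] by simp

text \<open>A prescribed value of the Bochner integral does not guarantee integrability; that comes
  from the Gaussian second moments.\<close>

lemma integrable_B_mult:
  assumes "0 \<le> t" "0 \<le> s"
  shows "integrable M (\<lambda>\<omega>. B t \<omega> * B s \<omega>)"
proof -
  have square: "integrable M (\<lambda>\<omega>. (B t \<omega>)\<^sup>2)" if "0 \<le> t" for t
    using gaussian_rv_abs_moment(1)[OF gaussian_B expectation_B, of t 2] that by simp
  have "\<bar>B t \<omega> * B s \<omega>\<bar> \<le> (B t \<omega>)\<^sup>2 + (B s \<omega>)\<^sup>2" for \<omega>
  proof -
    have "2 * (\<bar>B t \<omega>\<bar> * \<bar>B s \<omega>\<bar>) \<le> (B t \<omega>)\<^sup>2 + (B s \<omega>)\<^sup>2"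
      using sum_squares_bound[of "\<bar>B t \<omega>\<bar>" "\<bar>B s \<omega>\<bar>"] by simp
    moreover have "0 \<le> \<bar>B t \<omega>\<bar> * \<bar>B s \<omega>\<bar>"
      by simp
    ultimately show ?thesis
      unfolding abs_mult by linarith
  qed
  then show ?thesis
    using assms
    by (intro Bochner_Integration.integrable_bound[OF Bochner_Integration.integrable_add[OF square[of t] square[of s]]])
      (auto intro!: AE_I2)
qed

lemma integrable_B: "0 \<le> t \<Longrightarrow> integrable M (B t)"
  using integrable_B_mult[of t t] square_integrable_imp_integrable[of "B t"]
  by (simp add: power2_eq_square)

lemma cov_B: "0 \<le> t \<Longrightarrow> 0 \<le> s \<Longrightarrow> cov M (B t) (B s) = fbm_cov H t s"
  by (simp add: cov_def expectation_B expectation_B_mult)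

lemma expectation_linear_combination:
  assumes "\<And>i. i \<in> I \<Longrightarrow> 0 \<le> x i"
  shows "expectation (\<lambda>\<omega>. \<Sum>i\<in>I. c i * B (x i) \<omega>) = 0"
  using assms by (simp add: integrable_B expectation_B)

lemma expectation_linear_combination_mult_B:
  assumes "\<And>i. i \<in> I \<Longrightarrow> 0 \<le> x i" "0 \<le> t"
  shows "integrable M (\<lambda>\<omega>. (\<Sum>i\<in>I. c i * B (x i) \<omega>) * B t \<omega>)"
    and "expectation (\<lambda>\<omega>. (\<Sum>i\<in>I. c i * B (x i) \<omega>) * B t \<omega>) = (\<Sum>i\<in>I. c i * fbm_cov H (x i) t)"
  using assms by (simp_all add: sum_distrib_right mult.assoc integrable_B_mult expectation_B_mult)

lemma expectation_linear_combination_square: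
  assumes "\<And>i. i \<in> I \<Longrightarrow> 0 \<le> x i"
  shows "integrable M (\<lambda>\<omega>. (\<Sum>i\<in>I. c i * B (x i) \<omega>)\<^sup>2)"
    and "expectation (\<lambda>\<omega>. (\<Sum>i\<in>I. c i * B (x i) \<omega>)\<^sup>2)
      = (\<Sum>j\<in>I. c j * (\<Sum>i\<in>I. c i * fbm_cov H (x i) (x j)))"
proof -
  let ?Z = "\<lambda>\<omega>. \<Sum>i\<in>I. c i * B (x i) \<omega>"
  have eq: "(?Z \<omega>)\<^sup>2 = (\<Sum>j\<in>I. c j * (?Z \<omega> * B (x j) \<omega>))" for \<omega>
    by (simp add: power2_eq_square sum_distrib_left mult.left_commute)
  show "integrable M (\<lambda>\<omega>. (?Z \<omega>)\<^sup>2)"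
    unfolding eq using assms
    by (intro Bochner_Integration.integrable_sum integrable_mult_right
        expectation_linear_combination_mult_B) auto
  show "expectation (\<lambda>\<omega>. (?Z \<omega>)\<^sup>2) = (\<Sum>j\<in>I. c j * (\<Sum>i\<in>I. c i * fbm_cov H (x i) (x j)))"
    unfolding eq using assms
    by (simp add: expectation_linear_combination_mult_B)
qed

text \<open>The quadratic form is the second moment of \<open>?Z\<close>, so \<open>?Z\<close>
  vanishes almost surely. Hence it is orthogonal to \<open>B t\<close> for all
  \<open>t \<ge> 0\<close>, not only at the sampled times, as linear independence requires.\<close>

lemma fbm_cov_positive_definite:
  assumes I: "finite I" "inj_on x I" "\<And>i. i \<in> I \<Longrightarrow> 0 < x i"
    and zero: "(\<Sum>j\<in>I. c j * (\<Sum>i\<in>I. c i * fbm_cov H (x i) (x j))) = 0"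
    and k: "k \<in> I"
  shows "c k = 0"
proof -
  let ?Z = "\<lambda>\<omega>. \<Sum>i\<in>I. c i * B (x i) \<omega>"
  have nonneg: "i \<in> I \<Longrightarrow> 0 \<le> x i" for i
    using I(3) by (simp add: less_imp_le)
  have [measurable]: "?Z \<in> borel_measurable M"
    using nonneg by measurable
  have "expectation (\<lambda>\<omega>. (?Z \<omega>)\<^sup>2) = 0"
    using expectation_linear_combination_square(2)[of I x c] nonneg zero by simp
  then have "AE \<omega> in M. (?Z \<omega>)\<^sup>2 = 0"
    using integral_nonneg_eq_0_iff_AE[OF expectation_linear_combination_square(1)[of I x c]] nonneg
    by simp
  then have null: "AE \<omega> in M. ?Z \<omega> = 0"
    by simp
  have "(\<Sum>i\<in>I. c i * fbm_cov H (x i) t) = 0" if t: "0 \<le> t" for t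
  proof -
    have "expectation (\<lambda>\<omega>. ?Z \<omega> * B t \<omega>) = expectation (\<lambda>_. 0)"
      using null t by (intro integral_cong_AE) auto
    then show ?thesis
      using expectation_linear_combination_mult_B(2)[of I x t c] nonneg t by simp
  qed
  then show ?thesis
    using fbm_cov_linear_independent[OF hurst I _ k] by blast
qed

lemma fbm_cov_Cauchy_Schwarz:
  assumes I: "\<And>i. i \<in> I \<Longrightarrow> 0 \<le> x i" and t: "0 < t"
  shows "(\<Sum>i\<in>I. c i * fbm_cov H (x i) t)\<^sup>2
    \<le> (\<Sum>j\<in>I. c j * (\<Sum>i\<in>I. c i * fbm_cov H (x i) (x j))) * t powr (2 * H)"
proof -
  let ?Z = "\<lambda>\<omega>. \<Sum>i\<in>I. c i * B (x i) \<omega>"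
  define Q b V where "Q = (\<Sum>j\<in>I. c j * (\<Sum>i\<in>I. c i * fbm_cov H (x i) (x j)))"
    and "b = (\<Sum>i\<in>I. c i * fbm_cov H (x i) t)" and "V = t powr (2 * H)"
  have V: "fbm_cov H t t = V" "0 < V"
    using t by (simp_all add: fbm_cov_def V_def)
  \<comment> \<open>\<open>b / V\<close> is the regression coefficient of \<open>?Z\<close> on
    \<open>B t\<close>; the residual has nonnegative second moment.\<close>
  have "0 \<le> expectation (\<lambda>\<omega>. (?Z \<omega> - b / V * B t \<omega>)\<^sup>2)"
    by simp
  also have "\<dots> = expectation (\<lambda>\<omega>. (?Z \<omega>)\<^sup>2 - 2 * b / V * (?Z \<omega> * B t \<omega>) + (b / V)\<^sup>2 * (B t \<omega> * B t \<omega>))"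
    by (intro Bochner_Integration.integral_cong) (auto simp: power2_eq_square algebra_simps)
  also have "\<dots> = Q - 2 * b / V * b + (b / V)\<^sup>2 * V"
    using expectation_linear_combination_square[of I x c] I t
      expectation_linear_combination_mult_B[of I x t c] integrable_B_mult[of t t] expectation_B_mult[of t t] V
    by (simp add: Q_def b_def)
  finally have "0 \<le> (Q - 2 * b / V * b + (b / V)\<^sup>2 * V) * V"
    using V(2) by simp
  also have "\<dots> = Q * V - b\<^sup>2"
    using V(2) by (simp add: field_simps power2_eq_square)
  finally show ?thesis
    by (simp add: Q_def b_def V_def)
qed

section \<open>The estimation error and its variance\<close>

text \<open>\<open>D\<close> is both the denominator of the estimator and the variance of the
  combination with weights \<open>u\<close>, so a lower bound on \<open>D\<close> bounds the error
  variance from above.\<close>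

lemma drift_mle_error:
  assumes N: "1 \<le> N" and \<alpha>: "0 \<le> \<alpha>"
  defines "n \<equiv> num_obs \<alpha> N"
  obtains u D where "\<And>\<omega>. drift_mle M B \<alpha> a N \<omega> - a = (\<Sum>i=1..n. real N * u i / D * B (real i / real N) \<omega>)"
    and "expectation (\<lambda>\<omega>. (\<Sum>i=1..n. real N * u i / D * B (real i / real N) \<omega>)\<^sup>2)
      \<le> (real n / real N) powr (2 * H - 2)"
proof -
  define x where "x i = real i / real N" for i
  define G where "G = obs_cov_mat M B N n"
  define u where "u i = (\<Sum>j=1..n. inv_entry G i j * real j)" for i
  define D where "D = (\<Sum>i=1..n. u i * real i)"
  have inj: "inj_on x {1..n}" and pos: "\<And>i. i \<in> {1..n} \<Longrightarrow> 0 < x i"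
    and nonneg: "\<And>i. i \<in> {1..n} \<Longrightarrow> 0 \<le> x i"
    using N by (auto simp: inj_on_def x_def)
  have n: "1 \<le> n"
    using N \<alpha> ge_one_powr_ge_zero[of "real N" \<alpha>] by (simp add: n_def num_obs_def le_nat_floor)
  have G': "G = mat n n (\<lambda>(i, j). fbm_cov H (x (i + 1)) (x (j + 1)))"
    unfolding G_def obs_cov_mat_def x_def by (intro eq_matI) (simp_all add: cov_B)
  have solves: "(\<Sum>j=1..n. fbm_cov H (x i) (x j) * u j) = real i" if "i \<in> {1..n}" for i
    unfolding u_def
  proof (rule inv_entry_solves[OF G' _ that])
    fix w assume w: "\<And>i. i \<in> {1..n} \<Longrightarrow> (\<Sum>j=1..n. fbm_cov H (x i) (x j) * w j) = 0"
    have "(\<Sum>j=1..n. w j * (\<Sum>i=1..n. w i * fbm_cov H (x i) (x j))) = 0"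
      using w by (intro sum.neutral) (simp add: fbm_cov_commute mult.commute)
    then show "\<forall>i\<in>{1..n}. w i = 0"
      using fbm_cov_positive_definite[of "{1..n}" x w] inj pos by blast
  qed
  then have solves': "(\<Sum>j=1..n. u j * fbm_cov H (x j) (x i)) = real i" if "i \<in> {1..n}" for i
  proof -
    have "(\<Sum>j=1..n. u j * fbm_cov H (x j) (x i)) = (\<Sum>j=1..n. fbm_cov H (x i) (x j) * u j)"
      by (intro sum.cong refl) (metis fbm_cov_commute mult.commute)
    then show ?thesis
      using solves[OF that] by simp
  qed
  have quad: "(\<Sum>j=1..n. u j * (\<Sum>i=1..n. u i * fbm_cov H (x i) (x j))) = D"
    unfolding D_def by (intro sum.cong) (simp_all only: solves')
  \<comment> \<open>The test variable is the last observation time: by row \<open>n\<close> of the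
    system its covariance with the combination is \<open>n\<close>.\<close>
  have CS: "(real n)\<^sup>2 \<le> D * x n powr (2 * H)"
  proof -
    have n_in: "n \<in> {1..n}"
      using n by simp
    show ?thesis
      using fbm_cov_Cauchy_Schwarz[of "{1..n}" x "x n" u, OF nonneg pos[OF n_in]]
      unfolding quad solves'[OF n_in] .
  qed
  \<comment> \<open>Excludes division by zero in the estimator; it follows from \<open>CS\<close>
    because \<open>n\<close> is at least 1.\<close>
  have D: "0 < D"
  proof (rule ccontr)
    assume "\<not> 0 < D"
    then have "D * x n powr (2 * H) \<le> 0"
      by (simp add: mult_nonpos_nonneg)
    with CS n show False
      by (smt (verit) of_nat_1 of_nat_mono one_le_power)
  qed
  have numerator: "(\<Sum>i=1..n. \<Sum>j=1..n. real j * inv_entry G i j * observation a B N i \<omega>)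
      = (\<Sum>i=1..n. u i * observation a B N i \<omega>)" for \<omega>
    by (simp add: u_def sum_distrib_left sum_distrib_right mult_ac)
  have denominator: "(\<Sum>i=1..n. \<Sum>j=1..n. real i * real j * inv_entry G i j) = D"
    by (simp add: D_def u_def sum_distrib_left sum_distrib_right mult_ac)
  \<comment> \<open>The drift contributes a multiple of \<open>D\<close>, so after normalisation it
    gives exactly \<open>a\<close>: the estimator is unbiased.\<close>
  have drift: "(\<Sum>i=1..n. u i * observation a B N i \<omega>) = D * a / real N + (\<Sum>i=1..n. u i * B (x i) \<omega>)" for \<omega>
    by (simp add: observation_def D_def x_def distrib_left sum.distrib sum_distrib_left sum_distrib_right sum_divide_distrib mult_ac)
  show thesis
  proof (rule that[of u D])
    fix \<omega>
    have "drift_mle M B \<alpha> a N \<omega> = real N * ((D * a / real N + (\<Sum>i=1..n. u i * B (x i) \<omega>)) / D)"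
      unfolding drift_mle_def Let_def n_def[symmetric] G_def[symmetric] numerator denominator drift ..
    also have "\<dots> = a + real N / D * (\<Sum>i=1..n. u i * B (x i) \<omega>)"
      using D N by (simp add: field_simps)
    finally show "drift_mle M B \<alpha> a N \<omega> - a = (\<Sum>i=1..n. real N * u i / D * B (real i / real N) \<omega>)"
      by (simp add: x_def sum_distrib_left mult.assoc)
  next
    have "(\<Sum>i=1..n. real N * u i / D * B (x i) \<omega>) = real N / D * (\<Sum>i=1..n. u i * B (x i) \<omega>)" for \<omega>
      by (simp add: sum_distrib_left mult.assoc)
    then have "expectation (\<lambda>\<omega>. (\<Sum>i=1..n. real N * u i / D * B (x i) \<omega>)\<^sup>2) = (real N / D)\<^sup>2 * D"
      using expectation_linear_combination_square(2)[of "{1..n}" x u] nonneg quad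
      by (simp add: power_mult_distrib power_divide)
    also have "\<dots> = (real N)\<^sup>2 / D"
      using D by (simp add: power2_eq_square)
    \<comment> \<open>\<open>CS\<close> bounds \<open>1 / D\<close>, and \<open>N / n\<close> is the
      reciprocal of \<open>x n\<close>.\<close>
    also have "\<dots> \<le> x n powr (2 * H) / (x n)\<^sup>2"
      using CS D N n by (simp add: x_def field_simps)
    also have "\<dots> = x n powr (2 * H - 2)"
      using pos[of n] n by (simp add: powr_diff)
    finally show "expectation (\<lambda>\<omega>. (\<Sum>i=1..n. real N * u i / D * B (real i / real N) \<omega>)\<^sup>2)
        \<le> (real n / real N) powr (2 * H - 2)"
      by (simp add: x_def)
  qed
qed

end

section \<open>Growth of the observation horizon and convergence of the error moments\<close>

text \<open>Rounding down costs less than 1, hence at most 1 after division by \<open>N\<close>,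
  while \<open>N powr (\<alpha> - 1)\<close> diverges.\<close>

lemma num_obs_div_at_top:
  assumes "1 < \<alpha>"
  shows "filterlim (\<lambda>N. real (num_obs \<alpha> N) / real N) at_top sequentially"
proof (rule filterlim_at_top_mono)
  show "filterlim (\<lambda>N. real N powr (\<alpha> - 1) - 1) at_top sequentially"
    using assms by real_asymp
  show "eventually (\<lambda>N. real N powr (\<alpha> - 1) - 1 \<le> real (num_obs \<alpha> N) / real N) sequentially"
    using eventually_ge_at_top[of 1]
  proof eventually_elim
    case (elim N)
    have "real N powr \<alpha> - 1 \<le> real (num_obs \<alpha> N)"
      unfolding num_obs_def by linarith
    then have "(real N powr (\<alpha> - 1) - 1) * real N \<le> real (num_obs \<alpha> N)"
      using elim by (simp add: algebra_simps powr_diff)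
    then show ?case
      using elim by (simp add: field_simps)
  qed
qed

theorem proposition1:
  fixes M :: "'w measure" and B :: "real \<Rightarrow> 'w \<Rightarrow> real" and H a \<alpha> :: real
  assumes "prob_space M"
    and "0 < H" and "H < 1"
    and "fractional_brownian_motion M H B"
    and "\<alpha> > 1"
  shows "\<forall>p\<ge>1. Lp_consistent M p (drift_mle M B \<alpha> a) a"
proof (intro allI impI)
  fix p :: real assume p: "1 \<le> p"
  interpret fbm M H B
    using assms by (simp add: fbm_def fbm_axioms_def)
  define C where "C = (LINT x|lborel. std_normal_density x * \<bar>x\<bar> powr p)"
  define r where "r N = real (num_obs \<alpha> N) / real N" for N
  have C: "0 \<le> C"
    unfolding C_def by (intro Bochner_Integration.integral_nonneg) simp
  \<comment> \<open>The factor \<open>C\<close> does not depend on \<open>N\<close>, so the variance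
    bound alone governs the limit.\<close>
  have error: "drift_mle M B \<alpha> a N \<in> borel_measurable M \<and>
      integrable M (\<lambda>\<omega>. \<bar>drift_mle M B \<alpha> a N \<omega> - a\<bar> powr p) \<and>
      expectation (\<lambda>\<omega>. \<bar>drift_mle M B \<alpha> a N \<omega> - a\<bar> powr p)
        \<le> (r N powr (2 * H - 2)) powr (p / 2) * C" if N: "1 \<le> N" for N
  proof -
    let ?n = "num_obs \<alpha> N"
    have \<alpha>: "0 \<le> \<alpha>"
      using \<open>\<alpha> > 1\<close> by simp
    obtain u D where E: "\<And>\<omega>. drift_mle M B \<alpha> a N \<omega> - a
        = (\<Sum>i=1..?n. real N * u i / D * B (real i / real N) \<omega>)"
      and var: "expectation (\<lambda>\<omega>. (\<Sum>i=1..?n. real N * u i / D * B (real i / real N) \<omega>)\<^sup>2)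
        \<le> r N powr (2 * H - 2)"
      by (rule drift_mle_error[OF N \<alpha>, folded r_def]) (rule that)
    have gauss: "gaussian_rv M (\<lambda>\<omega>. drift_mle M B \<alpha> a N \<omega> - a)"
      unfolding E using N by (intro gaussian_linear_combination) (auto simp: inj_on_def)
    have mean: "expectation (\<lambda>\<omega>. drift_mle M B \<alpha> a N \<omega> - a) = 0"
      unfolding E by (rule expectation_linear_combination) simp
    have "(\<lambda>\<omega>. drift_mle M B \<alpha> a N \<omega> - a + a) \<in> borel_measurable M"
      using gauss unfolding gaussian_rv_def by (intro borel_measurable_add) auto
    moreover have "expectation (\<lambda>\<omega>. (drift_mle M B \<alpha> a N \<omega> - a)\<^sup>2) powr (p / 2) * C
        \<le> (r N powr (2 * H - 2)) powr (p / 2) * C"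
      using var p C unfolding E by (intro mult_right_mono powr_mono2) auto
    ultimately show ?thesis
      using gaussian_rv_abs_moment[OF gauss mean, of p] p by (simp add: C_def)
  qed
  \<comment> \<open>The exponent is negative because \<open>H < 1\<close>, so the diverging horizon
    \<open>r N\<close> drives the variance bound to 0.\<close>
  have "((\<lambda>y::real. y powr (2 * H - 2)) \<longlongrightarrow> 0) at_top"
    using \<open>H < 1\<close> by (intro tendsto_neg_powr filterlim_ident) simp
  then have "(\<lambda>N. r N powr (2 * H - 2)) \<longlonglongrightarrow> 0"
    unfolding r_def using num_obs_div_at_top[OF \<open>\<alpha> > 1\<close>] by (rule filterlim_compose)
  then have "(\<lambda>N. (r N powr (2 * H - 2)) powr (p / 2)) \<longlonglongrightarrow> 0"
    by (rule tendsto_zero_powrI[OF _ tendsto_const]) (use p in auto)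
  then have "(\<lambda>N. (r N powr (2 * H - 2)) powr (p / 2) * C) \<longlonglongrightarrow> 0"
    by (rule tendsto_mult_left_zero)
  then have "(\<lambda>N. expectation (\<lambda>\<omega>. \<bar>drift_mle M B \<alpha> a N \<omega> - a\<bar> powr p)) \<longlonglongrightarrow> 0"
    by (rule tendsto_sandwich[OF _ _ tendsto_const, rotated 2])
      (auto intro!: eventually_sequentiallyI[of 1] simp: error)
  then show "Lp_consistent M p (drift_mle M B \<alpha> a) a"
    using error by (simp add: Lp_consistent_def)
qed

end
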